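(* Let $(L_\delta)_{\delta\in[0,1)}$ be a one-parameter family of Markov operators which is a uniform family, i.e. satisfies: (UF1) there are constants $A,B,\lambda_1\ge0$ with $\lambda_1<1$ such that for all $f\in B_s$, $n\ge1$, $\delta\in[0,1)$: $\|L_\delta^nf\|_s\le A\lambda_1^n\|f\|_s+B\|f\|_w$; (UF2) there is $C\in\mathbb R$ such that for all $g\in B_s$ and $\delta\in[0,1)$: $\|(L_\delta-L_0)g\|_w\le\delta C\|g\|_s$; (UF3) $L_0$ has exponential convergence to equilibrium: there are $E\ge0$, $0\le\lambda_2<1$ with $\|L_0^ng\|_w\le E\lambda_2^n\|g\|_s$ for all $g\in V_s$, $n\ge0$; (UF4) there is $M$ such that for all $\delta\in[0,1)$, $n\geq 0$, $g\in B_s$: $\|L_\delta^ng\|_w\le M\|g\|_w$. Suppose $f_0\in B_s$ is the unique invariant probability measure of $L_0$ in $B_s$ and, for each $\delta$, $f_\delta\in B_s$ is an invariant probability measure of $L_\delta$. Then, as $\delta\to0$, $$\|f_\delta-f_0\|_w=O(\delta\log\delta),$$ i.e. there are $K,\delta_0>0$ with $\|f_\delta-f_0\|_w\le K\delta|\log\delta|$ for $0<\delta\le\delta_0$.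
   Context: $X$ is a metric space, $SM(X)$ the space of finite signed Borel measures on $X$, and $B_s\subseteq B_w\subseteq SM(X)$ are vector subspaces with norms $\|\cdot\|_s$ on $B_s$ and $\|\cdot\|_w$ on $B_w$, $\|\cdot\|_s\ge\|\cdot\|_w$ on $B_s$. A Markov operator is a linear operator mapping positive measures to positive measures with $[L\mu](X)=\mu(X)$. $L_\delta(B_s)\subseteq B_s$ and $L_\delta(B_w)\subseteq B_w$. $V_s=\{g\in B_s:g(X)=0\}$. *)

theory Defs
  imports "HOL-Analysis.Analysis"
begin

text \<open>
  Finite signed Borel measures, as countably additive real-valued set functions on the Borel sets.
  Unconditional convergence of the series is automatic, since every reordering of a disjoint
  family is again a disjoint family. As for the library's \<open>measure\<close>, the value outside the
  \<open>\<sigma>\<close>-algebra is fixed to 0, so that equality of set functions is equality of measures.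
\<close>

definition is_signed_measure :: "('a::topological_space set \<Rightarrow> real) \<Rightarrow> bool" where
  "is_signed_measure \<mu> \<longleftrightarrow>
     \<mu> {} = 0 \<and>
     (\<forall>A :: nat \<Rightarrow> 'a set. range A \<subseteq> sets borel \<longrightarrow> disjoint_family A \<longrightarrow>
        (\<lambda>i. \<mu> (A i)) sums \<mu> (\<Union>i. A i)) \<and>
     (\<forall>A. A \<notin> sets borel \<longrightarrow> \<mu> A = 0)"

typedef (overloaded) 'a signed_measure =
  "{\<mu> :: 'a::topological_space set \<Rightarrow> real. is_signed_measure \<mu>}"
  morphisms mass Signed_Measure
  by (rule exI[of _ "\<lambda>_. 0"]) (simp add: is_signed_measure_def)

lemma is_signed_measure_mass: "is_signed_measure (mass \<mu>)"
  using mass[of \<mu>] by simp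

instantiation signed_measure :: (topological_space) real_vector
begin

definition zero_signed_measure :: "'a signed_measure" where
  "0 = Signed_Measure (\<lambda>_. 0)"

definition plus_signed_measure :: "'a signed_measure \<Rightarrow> 'a signed_measure \<Rightarrow> 'a signed_measure" where
  "\<mu> + \<nu> = Signed_Measure (\<lambda>A. mass \<mu> A + mass \<nu> A)"

definition uminus_signed_measure :: "'a signed_measure \<Rightarrow> 'a signed_measure" where
  "- \<mu> = Signed_Measure (\<lambda>A. - mass \<mu> A)"

definition minus_signed_measure :: "'a signed_measure \<Rightarrow> 'a signed_measure \<Rightarrow> 'a signed_measure" where
  "\<mu> - \<nu> = Signed_Measure (\<lambda>A. mass \<mu> A - mass \<nu> A)"

definition scaleR_signed_measure :: "real \<Rightarrow> 'a signed_measure \<Rightarrow> 'a signed_measure" where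
  "c *\<^sub>R \<mu> = Signed_Measure (\<lambda>A. c * mass \<mu> A)"

lemma mass_zero: "mass (0 :: 'a signed_measure) A = 0"
  by (simp add: zero_signed_measure_def Signed_Measure_inverse is_signed_measure_def)

lemma mass_add: "mass (\<mu> + \<nu> :: 'a signed_measure) A = mass \<mu> A + mass \<nu> A"
proof -
  have "is_signed_measure (\<lambda>A. mass \<mu> A + mass \<nu> A)"
    using is_signed_measure_mass[of \<mu>] is_signed_measure_mass[of \<nu>]
    unfolding is_signed_measure_def by (auto intro: sums_add)
  then show ?thesis by (simp add: plus_signed_measure_def Signed_Measure_inverse)
qed

lemma mass_uminus: "mass (- \<mu> :: 'a signed_measure) A = - mass \<mu> A"
proof -
  have "is_signed_measure (\<lambda>A. - mass \<mu> A)"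
    using is_signed_measure_mass[of \<mu>]
    unfolding is_signed_measure_def by (auto intro: sums_minus)
  then show ?thesis by (simp add: uminus_signed_measure_def Signed_Measure_inverse)
qed

lemma mass_diff: "mass (\<mu> - \<nu> :: 'a signed_measure) A = mass \<mu> A - mass \<nu> A"
proof -
  have "is_signed_measure (\<lambda>A. mass \<mu> A - mass \<nu> A)"
    using is_signed_measure_mass[of \<mu>] is_signed_measure_mass[of \<nu>]
    unfolding is_signed_measure_def by (auto intro: sums_diff)
  then show ?thesis by (simp add: minus_signed_measure_def Signed_Measure_inverse)
qed

lemma mass_scaleR: "mass (c *\<^sub>R \<mu> :: 'a signed_measure) A = c * mass \<mu> A"
proof -
  have "is_signed_measure (\<lambda>A. c * mass \<mu> A)"
    using is_signed_measure_mass[of \<mu>]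
    unfolding is_signed_measure_def by (auto intro: sums_mult)
  then show ?thesis by (simp add: scaleR_signed_measure_def Signed_Measure_inverse)
qed

instance
  by standard
    (simp_all add: mass_inject[symmetric] fun_eq_iff mass_zero mass_add mass_uminus mass_diff
      mass_scaleR algebra_simps)

end

definition positive_measure :: "'a::topological_space signed_measure \<Rightarrow> bool" where
  "positive_measure \<mu> \<longleftrightarrow> (\<forall>A \<in> sets borel. 0 \<le> mass \<mu> A)"

definition probability_measure :: "'a::topological_space signed_measure \<Rightarrow> bool" where
  "probability_measure \<mu> \<longleftrightarrow> positive_measure \<mu> \<and> mass \<mu> UNIV = 1"

definition markov_operator ::
    "('a::topological_space signed_measure \<Rightarrow> 'a signed_measure) \<Rightarrow> bool" where
  "markov_operator L \<longleftrightarrow>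
     linear L \<and>
     (\<forall>\<mu>. positive_measure \<mu> \<longrightarrow> positive_measure (L \<mu>)) \<and>
     (\<forall>\<mu>. mass (L \<mu>) UNIV = mass \<mu> UNIV)"

definition invariant_probability ::
    "('a::topological_space signed_measure \<Rightarrow> 'a signed_measure) \<Rightarrow> 'a signed_measure \<Rightarrow> bool" where
  "invariant_probability L \<mu> \<longleftrightarrow> probability_measure \<mu> \<and> L \<mu> = \<mu>"

text \<open>A norm given only on a subspace; its values elsewhere are irrelevant.\<close>

definition norm_on :: "'v::real_vector set \<Rightarrow> ('v \<Rightarrow> real) \<Rightarrow> bool" where
  "norm_on V N \<longleftrightarrow>
     (\<forall>x\<in>V. 0 \<le> N x) \<and>
     (\<forall>x\<in>V. N x = 0 \<longleftrightarrow> x = 0) \<and>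
     (\<forall>x\<in>V. \<forall>c. N (c *\<^sub>R x) = \<bar>c\<bar> * N x) \<and>
     (\<forall>x\<in>V. \<forall>y\<in>V. N (x + y) \<le> N x + N y)"

definition zero_mass_part :: "'a::topological_space signed_measure set \<Rightarrow> 'a signed_measure set" where
  "zero_mass_part B = {g \<in> B. mass g UNIV = 0}"

definition uniform_family ::
    "'a::topological_space signed_measure set \<Rightarrow> ('a signed_measure \<Rightarrow> real) \<Rightarrow>
     ('a signed_measure \<Rightarrow> real) \<Rightarrow> (real \<Rightarrow> 'a signed_measure \<Rightarrow> 'a signed_measure) \<Rightarrow> bool" where
  "uniform_family Bs norm_s norm_w L \<longleftrightarrow>
     (\<exists>A B l1. 0 \<le> A \<and> 0 \<le> B \<and> 0 \<le> l1 \<and> l1 < 1 \<and>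
        (\<forall>f\<in>Bs. \<forall>n\<ge>1. \<forall>\<delta>\<in>{0..<1}.
           norm_s ((L \<delta> ^^ n) f) \<le> A * l1 ^ n * norm_s f + B * norm_w f)) \<and>
     (\<exists>C. \<forall>g\<in>Bs. \<forall>\<delta>\<in>{0..<1}. norm_w (L \<delta> g - L 0 g) \<le> \<delta> * C * norm_s g) \<and>
     (\<exists>E l2. 0 \<le> E \<and> 0 \<le> l2 \<and> l2 < 1 \<and>
        (\<forall>g\<in>zero_mass_part Bs. \<forall>n. norm_w ((L 0 ^^ n) g) \<le> E * l2 ^ n * norm_s g)) \<and>
     (\<exists>M. \<forall>\<delta>\<in>{0..<1}. \<forall>n. \<forall>g\<in>Bs. norm_w ((L \<delta> ^^ n) g) \<le> M * norm_w g)"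

end

theory Submission
  imports Defs "HOL-Real_Asymp.Real_Asymp"
begin

text \<open>
  Write \<open>g = f \<delta> - f 0\<close>. Both measures are fixed points, so for every \<open>n\<close>
  \[ g = L_0^n g + (f_\delta - L_0^n f_\delta). \]
  The measure \<open>g\<close> has zero mass, so convergence to equilibrium bounds the first term by
  \<open>E * l2 ^ n * norm_s g\<close>. The second term telescopes into \<open>n\<close> images under powers of \<open>L 0\<close> of
  the single defect \<open>L \<delta> (f \<delta>) - L 0 (f \<delta>)\<close>, hence is at most
  \<open>n * \<bar>M\<bar> * \<delta> * \<bar>C\<bar> * norm_s (f \<delta>)\<close> (lemma \<open>fixed_point_defect_le\<close>). Taking \<open>n\<close>
  proportional to \<open>- ln \<delta>\<close> makes \<open>l2 ^ n\<close> at most \<open>\<delta>\<close>, so that both coefficients are at most a multiple of \<open>\<delta> * \<bar>ln \<delta>\<bar>\<close>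
  (lemma \<open>geometric_linear_tradeoff\<close>).

  It remains to control the strong norms of \<open>g\<close> and \<open>f \<delta>\<close> uniformly in \<open>\<delta>\<close>. The Lasota-Yorke
  inequality at a fixed point gives \<open>norm_s (f \<delta>) \<le> B * norm_w (f \<delta>)\<close>
  (lemma \<open>strong_le_weak_at_fixed_point\<close>), but the weak norm of an invariant
  probability measure has no evident bound uniform in \<open>\<delta>\<close>. Instead
  \<open>norm_w (f \<delta>) \<le> norm_w g + norm_w (f 0)\<close>, and the estimate becomes the self-referential
  inequality
  \[ \|g\|_w \le K \delta |\log \delta| \, B \, (\|g\|_w + 2 \|f_0\|_w). \]
  Once \<open>\<delta>\<close> is so small that \<open>K * \<delta> * \<bar>ln \<delta>\<bar> * B \<le> 1/2\<close>, the occurrence of \<open>g\<close> on the right is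
  absorbed into the left-hand side.
\<close>

section \<open>Norms on a subspace\<close>

lemma norm_on_nonneg: "norm_on V N \<Longrightarrow> x \<in> V \<Longrightarrow> 0 \<le> N x"
  by (simp add: norm_on_def)

lemma norm_on_zero: "norm_on V N \<Longrightarrow> 0 \<in> V \<Longrightarrow> N 0 = 0"
  by (simp add: norm_on_def)

lemma norm_on_triangle: "norm_on V N \<Longrightarrow> x \<in> V \<Longrightarrow> y \<in> V \<Longrightarrow> N (x + y) \<le> N x + N y"
  by (simp add: norm_on_def)

lemma norm_on_diff_le:
  assumes "norm_on V N" "subspace V" "x \<in> V" "y \<in> V"
  shows "N (x - y) \<le> N x + N y"
proof -
  have "N (x + (-1) *\<^sub>R y) \<le> N x + N ((-1) *\<^sub>R y)"
    using assms by (intro norm_on_triangle) (auto intro: subspace_neg)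
  moreover have "N ((-1) *\<^sub>R y) = N y"
    using assms(1,4) unfolding norm_on_def by (metis abs_minus_cancel abs_one mult_1)
  ultimately show ?thesis by simp
qed

section \<open>Iterates and fixed points\<close>

lemma linear_funpow:
  fixes T :: "'v::real_vector \<Rightarrow> 'v"
  assumes "linear T"
  shows "linear (T ^^ n)"
proof (induction n)
  case 0
  show ?case by (simp add: linear_iff)
next
  case (Suc n)
  show ?case unfolding funpow.simps(2) using Suc.IH assms by (rule linear_compose)
qed

lemma funpow_fixed_point: "T x = x \<Longrightarrow> (T ^^ n) x = x"
  by (induction n) auto

lemma funpow_in_invariant_set: "T ` V \<subseteq> V \<Longrightarrow> x \<in> V \<Longrightarrow> (T ^^ n) x \<in> V"
  by (induction n) auto

text \<open>At a fixed point the left-hand side of a Lasota-Yorke inequality is independent of \<open>n\<close>,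
  while its contracting term vanishes as \<open>n\<close> grows.\<close>

lemma strong_le_weak_at_fixed_point:
  fixes p q :: "'v \<Rightarrow> real"
  assumes LY: "\<And>n. 1 \<le> n \<Longrightarrow> p ((T ^^ n) x) \<le> A * l ^ n * p x + B * q x"
    and "0 \<le> l" "l < 1" and "T x = x"
  shows "p x \<le> B * q x"
proof -
  have "(\<lambda>n. A * l ^ n * p x + B * q x) \<longlonglongrightarrow> A * 0 * p x + B * q x"
    using assms by (intro tendsto_intros LIMSEQ_realpow_zero) auto
  moreover have "\<forall>n\<ge>1. p x \<le> A * l ^ n * p x + B * q x"
    using LY \<open>T x = x\<close> by (simp add: funpow_fixed_point)
  ultimately show ?thesis
    by (intro LIMSEQ_le_const[where X = "\<lambda>n. A * l ^ n * p x + B * q x"]) auto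
qed

text \<open>The difference \<open>x - (T ^^ n) x\<close> telescopes into the images of the one-step defect \<open>x - T x\<close>
  under the powers \<open>T ^^ k\<close> with \<open>k < n\<close>, so it grows at most linearly when these powers are
  uniformly bounded.\<close>

lemma fixed_point_defect_le:
  fixes T :: "'v::real_vector \<Rightarrow> 'v"
  assumes "norm_on V N" "subspace V" "linear T" "T ` V \<subseteq> V" "x \<in> V"
    and bound: "\<And>k. N ((T ^^ k) (x - T x)) \<le> D"
  shows "N (x - (T ^^ n) x) \<le> real n * D"
proof (induction n)
  case 0
  then show ?case using assms(1,2) by (simp add: norm_on_zero subspace_0)
next
  case (Suc n)
  have mem: "(T ^^ k) y \<in> V" if "y \<in> V" for k y
    using funpow_in_invariant_set[OF assms(4) that] .
  have "T x \<in> V" using assms(4,5) by blast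
  have "x - (T ^^ Suc n) x = (x - (T ^^ n) x) + (T ^^ n) (x - T x)"
    by (simp add: linear_diff[OF linear_funpow[OF \<open>linear T\<close>]] funpow_swap1)
  also have "N \<dots> \<le> N (x - (T ^^ n) x) + N ((T ^^ n) (x - T x))"
    using assms(1,2,5) mem \<open>T x \<in> V\<close> by (intro norm_on_triangle) (auto intro: subspace_diff)
  also have "\<dots> \<le> real n * D + D"
    using Suc.IH bound by (intro add_mono)
  finally show ?case by (simp add: algebra_simps)
qed

section \<open>Logarithmic iteration times\<close>

text \<open>Balancing a geometrically decaying term against a linearly growing one: if \<open>l ^ m\<close> is below
  \<open>1 / e\<close>, then \<open>n = m * \<lceil>- ln \<delta>\<rceil>\<close> brings \<open>l ^ n\<close> below \<open>\<delta>\<close>, at a cost \<open>n\<close> that is only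
  logarithmic in \<open>1 / \<delta>\<close>. The restriction to \<open>\<delta> \<le> 1 / e\<close> means \<open>1 \<le> \<bar>ln \<delta>\<bar>\<close>, so that constants
  and rounding errors are dominated by \<open>\<bar>ln \<delta>\<bar>\<close>.\<close>

lemma geometric_linear_tradeoff:
  fixes a b l :: real
  assumes "0 \<le> a" "0 \<le> b" "0 \<le> l" "l < 1"
  obtains K where "0 < K"
    and "\<And>\<delta>. 0 < \<delta> \<Longrightarrow> \<delta> \<le> exp (-1) \<Longrightarrow>
           \<exists>n. a * l ^ n + real n * (b * \<delta>) \<le> K * (\<delta> * \<bar>ln \<delta>\<bar>)"
proof -
  obtain m where m: "l ^ m < exp (-1)"
    using real_arch_pow_inv[of "exp (-1)" l] \<open>l < 1\<close> by auto
  define K where "K = a + 2 * real m * b + 1"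
  show thesis
  proof
    show "0 < K" using assms by (simp add: K_def add_nonneg_pos)
    fix \<delta> :: real
    assume \<delta>: "0 < \<delta>" "\<delta> \<le> exp (-1)"
    define t where "t = - ln \<delta>"
    have "ln \<delta> \<le> ln (exp (-1))" using \<delta> by (subst ln_le_cancel_iff) auto
    then have t: "1 \<le> t" "\<bar>ln \<delta>\<bar> = t" by (auto simp: t_def)
    define k where "k = nat \<lceil>t\<rceil>"
    have k: "t \<le> real k" "real k \<le> 2 * t" using t by (auto simp: k_def) linarith+
    have "l ^ (m * k) \<le> exp (-1) ^ k"
      unfolding power_mult using m \<open>0 \<le> l\<close> by (intro power_mono) auto
    also have "\<dots> = exp (- real k)" by (simp flip: exp_of_nat_mult)
    also have "\<dots> \<le> exp (- t)" using k by simp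
    also have "\<dots> = \<delta>" using \<delta> by (simp add: t_def)
    also have "\<delta> \<le> \<delta> * t" using \<delta> t by simp
    finally have "a * l ^ (m * k) \<le> a * (\<delta> * t)"
      using \<open>0 \<le> a\<close> by (rule mult_left_mono)
    moreover have "real m * real k * (b * \<delta>) \<le> real m * (2 * t) * (b * \<delta>)"
      using k \<delta> \<open>0 \<le> b\<close> by (intro mult_right_mono mult_left_mono) auto
    moreover have "0 \<le> \<delta> * t" using \<delta> t by simp
    ultimately have "a * l ^ (m * k) + real (m * k) * (b * \<delta>) \<le> K * (\<delta> * \<bar>ln \<delta>\<bar>)"
      unfolding t(2) K_def by (simp add: algebra_simps)
    then show "\<exists>n. a * l ^ n + real n * (b * \<delta>) \<le> K * (\<delta> * \<bar>ln \<delta>\<bar>)" by blast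
  qed
qed

lemma mult_ln_small:
  fixes \<epsilon> :: real
  assumes "0 < \<epsilon>"
  obtains d where "0 < d" and "\<And>\<delta>. 0 < \<delta> \<Longrightarrow> \<delta> \<le> d \<Longrightarrow> \<delta> * \<bar>ln \<delta>\<bar> \<le> \<epsilon>"
proof -
  have "((\<lambda>\<delta>::real. \<delta> * \<bar>ln \<delta>\<bar>) \<longlongrightarrow> 0) (at_right 0)" by real_asymp
  then have "eventually (\<lambda>\<delta>::real. \<delta> * \<bar>ln \<delta>\<bar> < \<epsilon>) (at_right 0)"
    using assms by (rule order_tendstoD)
  then obtain b :: real where b: "0 < b" "\<And>\<delta>. 0 < \<delta> \<Longrightarrow> \<delta> < b \<Longrightarrow> \<delta> * \<bar>ln \<delta>\<bar> < \<epsilon>"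
    unfolding eventually_at_right_field by auto
  show thesis
    using b by (intro that[of "b / 2"]) (auto intro: less_imp_le)
qed

section \<open>Stability of invariant measures\<close>

theorem proposition38:
  fixes Bs Bw :: "'a::metric_space signed_measure set"
    and norm_s norm_w :: "'a signed_measure \<Rightarrow> real"
    and L :: "real \<Rightarrow> 'a signed_measure \<Rightarrow> 'a signed_measure"
    and f :: "real \<Rightarrow> 'a signed_measure"
  assumes "subspace Bs" and "subspace Bw" and "Bs \<subseteq> Bw"
    and "norm_on Bs norm_s" and "norm_on Bw norm_w"
    and "\<And>g. g \<in> Bs \<Longrightarrow> norm_w g \<le> norm_s g"
    and "\<And>\<delta>. \<delta> \<in> {0..<1} \<Longrightarrow> markov_operator (L \<delta>)"
    and "\<And>\<delta>. \<delta> \<in> {0..<1} \<Longrightarrow> L \<delta> ` Bs \<subseteq> Bs"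
    and "\<And>\<delta>. \<delta> \<in> {0..<1} \<Longrightarrow> L \<delta> ` Bw \<subseteq> Bw"
    and "uniform_family Bs norm_s norm_w L"
    and "\<And>\<delta>. \<delta> \<in> {0..<1} \<Longrightarrow> f \<delta> \<in> Bs \<and> invariant_probability (L \<delta>) (f \<delta>)"
    and "\<And>g. g \<in> Bs \<Longrightarrow> invariant_probability (L 0) g \<Longrightarrow> g = f 0"
  shows "\<exists>K \<delta>\<^sub>0. 0 < K \<and> 0 < \<delta>\<^sub>0 \<and> \<delta>\<^sub>0 < 1 \<and>
    (\<forall>\<delta>. 0 < \<delta> \<and> \<delta> \<le> \<delta>\<^sub>0 \<longrightarrow> norm_w (f \<delta> - f 0) \<le> K * \<delta> * \<bar>ln \<delta>\<bar>)"
proof -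
  define w where "w \<delta> = norm_w (f \<delta> - f 0)" for \<delta>
  define a where "a = norm_w (f 0)"
  note uf = assms(10)[unfolded uniform_family_def]
  obtain A B l1 where B: "0 \<le> B" and l1: "0 \<le> l1" "l1 < 1"
    and LY: "\<forall>h\<in>Bs. \<forall>n\<ge>1. \<forall>\<delta>\<in>{0..<1}.
               norm_s ((L \<delta> ^^ n) h) \<le> A * l1 ^ n * norm_s h + B * norm_w h"
    using uf[THEN conjunct1] by (elim exE conjE)
  obtain C where C: "\<forall>h\<in>Bs. \<forall>\<delta>\<in>{0..<1}. norm_w (L \<delta> h - L 0 h) \<le> \<delta> * C * norm_s h"
    using uf[THEN conjunct2, THEN conjunct1] by (elim exE)
  obtain E l2 where E: "0 \<le> E" and l2: "0 \<le> l2" "l2 < 1"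
    and eq: "\<forall>h\<in>zero_mass_part Bs. \<forall>n. norm_w ((L 0 ^^ n) h) \<le> E * l2 ^ n * norm_s h"
    using uf[THEN conjunct2, THEN conjunct2, THEN conjunct1] by (elim exE conjE)
  obtain M where M: "\<forall>\<delta>\<in>{0..<1}. \<forall>n. \<forall>h\<in>Bs. norm_w ((L \<delta> ^^ n) h) \<le> M * norm_w h"
    using uf[THEN conjunct2, THEN conjunct2, THEN conjunct2] by (elim exE)
  have nonneg_s: "0 \<le> norm_s h" if "h \<in> Bs" for h
    using norm_on_nonneg[OF assms(4) that] .
  have norm_w: "norm_on Bs norm_w"
    using assms(3,5) unfolding norm_on_def by (simp add: subset_iff)
  have nonneg_w: "0 \<le> norm_w h" if "h \<in> Bs" for h
    using norm_on_nonneg[OF norm_w that] .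
  have f0: "f 0 \<in> Bs" "L 0 (f 0) = f 0" "mass (f 0) UNIV = 1"
    using assms(11)[of 0] by (auto simp: invariant_probability_def probability_measure_def)
  have lin: "linear (L 0)" using assms(7)[of 0] by (simp add: markov_operator_def)
  have "0 \<le> a" using nonneg_w f0 by (simp add: a_def)

  \<comment> \<open>The constants \<open>C\<close> and \<open>M\<close> may be negative; their absolute values serve as well.\<close>
  define b where "b = \<bar>M\<bar> * \<bar>C\<bar>"
  have self_bound: "w \<delta> \<le> (E * l2 ^ n + real n * (b * \<delta>)) * (B * (w \<delta> + 2 * a))"
    if \<delta>: "0 < \<delta>" "\<delta> < 1" for \<delta> n
  proof -
    have \<delta>': "\<delta> \<in> {0..<1}" using \<delta> by simp
    have f\<delta>: "f \<delta> \<in> Bs" "L \<delta> (f \<delta>) = f \<delta>" "mass (f \<delta>) UNIV = 1"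
      using assms(11)[OF \<delta>'] by (auto simp: invariant_probability_def probability_measure_def)
    define g where "g = f \<delta> - f 0"
    have gs: "g \<in> Bs" using f0 f\<delta> assms(1) by (simp add: g_def subspace_diff)
    have gV: "g \<in> zero_mass_part Bs"
      using gs f0 f\<delta> by (simp add: zero_mass_part_def g_def mass_diff)
    have "norm_w (f \<delta>) \<le> w \<delta> + a"
      using norm_on_triangle[OF norm_w gs f0(1)] by (simp add: g_def w_def a_def)
    have "norm_s (f \<delta>) \<le> B * norm_w (f \<delta>)"
      by (rule strong_le_weak_at_fixed_point
          [of norm_s "L \<delta>" "f \<delta>" A l1 B norm_w]) (use LY \<delta>' f\<delta> l1 in auto)
    also have "\<dots> \<le> B * (w \<delta> + a)"
      using \<open>norm_w (f \<delta>) \<le> w \<delta> + a\<close> B by (rule mult_left_mono)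
    finally have sf\<delta>: "norm_s (f \<delta>) \<le> B * (w \<delta> + a)" .
    have sf0: "norm_s (f 0) \<le> B * a"
      unfolding a_def
      by (rule strong_le_weak_at_fixed_point
          [of norm_s "L 0" "f 0" A l1 B norm_w]) (use LY f0 l1 in auto)
    have "norm_s g \<le> norm_s (f \<delta>) + norm_s (f 0)"
      unfolding g_def using assms(4,1) f\<delta>(1) f0(1) by (rule norm_on_diff_le)
    then have sg: "norm_s g \<le> B * (w \<delta> + 2 * a)"
      using sf\<delta> sf0 by (simp add: algebra_simps)
    have sf\<delta>': "norm_s (f \<delta>) \<le> B * (w \<delta> + 2 * a)"
      using sf\<delta> mult_nonneg_nonneg[OF B \<open>0 \<le> a\<close>] by (simp add: algebra_simps)

    have L0f: "f \<delta> - L 0 (f \<delta>) \<in> Bs" "L 0 ` Bs \<subseteq> Bs"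
      using f\<delta>(1) assms(1) assms(8)[of 0] by (auto intro!: subspace_diff)
    have defect: "norm_w ((L 0 ^^ k) (f \<delta> - L 0 (f \<delta>))) \<le> b * \<delta> * norm_s (f \<delta>)" for k
    proof -
      have "norm_w ((L 0 ^^ k) (f \<delta> - L 0 (f \<delta>))) \<le> M * norm_w (f \<delta> - L 0 (f \<delta>))"
        using M L0f(1) by simp
      also have "\<dots> \<le> \<bar>M\<bar> * norm_w (f \<delta> - L 0 (f \<delta>))"
        using nonneg_w[OF L0f(1)] by (intro mult_right_mono) auto
      also have "\<dots> \<le> \<bar>M\<bar> * (\<delta> * C * norm_s (f \<delta>))"
        using bspec[OF bspec[OF C f\<delta>(1)] \<delta>'] f\<delta>(2) by (intro mult_left_mono) auto
      also have "\<dots> \<le> \<bar>M\<bar> * (\<delta> * \<bar>C\<bar> * norm_s (f \<delta>))"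
        using \<delta> nonneg_s[OF f\<delta>(1)] by (intro mult_left_mono mult_right_mono) auto
      finally show ?thesis by (simp add: b_def mult_ac)
    qed
    have "norm_w (f \<delta> - (L 0 ^^ n) (f \<delta>)) \<le> real n * (b * \<delta> * norm_s (f \<delta>))"
      using norm_w assms(1) lin L0f(2) f\<delta>(1) defect by (rule fixed_point_defect_le)
    also have "\<dots> = real n * (b * \<delta>) * norm_s (f \<delta>)" by simp
    also have "\<dots> \<le> real n * (b * \<delta>) * (B * (w \<delta> + 2 * a))"
      using sf\<delta>' \<delta> by (intro mult_left_mono) (auto simp: b_def)
    finally have second: "norm_w (f \<delta> - (L 0 ^^ n) (f \<delta>)) \<le> \<dots>" .
    have "norm_w ((L 0 ^^ n) g) \<le> E * l2 ^ n * norm_s g" using eq gV by blast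
    also have "\<dots> \<le> E * l2 ^ n * (B * (w \<delta> + 2 * a))"
      using sg E l2 by (intro mult_left_mono) auto
    finally have first: "norm_w ((L 0 ^^ n) g) \<le> \<dots>" .
    have split: "g = (L 0 ^^ n) g + (f \<delta> - (L 0 ^^ n) (f \<delta>))"
      using linear_diff[OF linear_funpow[OF lin]] funpow_fixed_point[of "L 0" "f 0", OF f0(2)]
      unfolding g_def by simp
    have mem: "(L 0 ^^ n) h \<in> Bs" if "h \<in> Bs" for h
      using L0f(2) that by (rule funpow_in_invariant_set)
    have "norm_w ((L 0 ^^ n) g + (f \<delta> - (L 0 ^^ n) (f \<delta>)))
        \<le> norm_w ((L 0 ^^ n) g) + norm_w (f \<delta> - (L 0 ^^ n) (f \<delta>))"
      using mem[OF gs] subspace_diff[OF assms(1) f\<delta>(1) mem[OF f\<delta>(1)]]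
      by (rule norm_on_triangle[OF norm_w])
    then have "norm_w g \<le> norm_w ((L 0 ^^ n) g) + norm_w (f \<delta> - (L 0 ^^ n) (f \<delta>))"
      by (simp only: split[symmetric])
    then show ?thesis
      using first second by (simp add: w_def g_def distrib_right)
  qed

  have "0 \<le> b" by (simp add: b_def)
  obtain K where K: "0 < K"
    and opt: "\<And>\<delta>. 0 < \<delta> \<Longrightarrow> \<delta> \<le> exp (-1) \<Longrightarrow>
           \<exists>n. E * l2 ^ n + real n * (b * \<delta>) \<le> K * (\<delta> * \<bar>ln \<delta>\<bar>)"
    by (rule geometric_linear_tradeoff[OF E \<open>0 \<le> b\<close> l2]) (erule that, blast)
  have pos: "0 < K * B + 1" using K B by (simp add: add_nonneg_pos)
  then have eps: "0 < 1 / (2 * (K * B + 1))" by simp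
  \<comment> \<open>This smallness brings the coefficient of \<open>w \<delta>\<close> in \<open>self_bound\<close> below \<open>1/2\<close>; the summand
      \<open>1\<close> covers \<open>B = 0\<close>.\<close>
  obtain d where d: "0 < d"
    and small: "\<And>\<delta>. 0 < \<delta> \<Longrightarrow> \<delta> \<le> d \<Longrightarrow> \<delta> * \<bar>ln \<delta>\<bar> \<le> 1 / (2 * (K * B + 1))"
    by (rule mult_ln_small[OF eps]) (erule that, blast)
  define d0 where "d0 = min d (exp (-1))"
  have "norm_w (f \<delta> - f 0) \<le> (4 * K * B * a + 1) * \<delta> * \<bar>ln \<delta>\<bar>"
    if \<delta>: "0 < \<delta>" "\<delta> \<le> d0" for \<delta>
  proof -
    have le: "\<delta> \<le> d" "\<delta> \<le> exp (-1)" using \<delta> by (auto simp: d0_def)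
    have "exp (-1 :: real) < 1" by simp
    with le have \<delta>1: "\<delta> < 1" by linarith
    define s where "s = \<delta> * \<bar>ln \<delta>\<bar>"
    have s: "0 \<le> s" using \<delta> by (simp add: s_def)
    have "w \<delta> \<ge> 0"
      using nonneg_w assms(1,11) f0(1) \<delta> \<delta>1 by (simp add: w_def subspace_diff)
    obtain n where n: "E * l2 ^ n + real n * (b * \<delta>) \<le> K * s"
      using opt[OF \<delta>(1) le(2)] unfolding s_def by blast
    have "w \<delta> \<le> (E * l2 ^ n + real n * (b * \<delta>)) * (B * (w \<delta> + 2 * a))"
      using self_bound[OF \<delta>(1) \<delta>1] .
    also have "\<dots> \<le> K * s * (B * (w \<delta> + 2 * a))"
      using n B \<open>0 \<le> a\<close> \<open>w \<delta> \<ge> 0\<close> by (intro mult_right_mono) auto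
    also have "\<dots> = K * B * s * w \<delta> + 2 * K * B * a * s" by (simp add: algebra_simps)
    also have "K * B * s * w \<delta> \<le> 1 / 2 * w \<delta>"
    proof (rule mult_right_mono)
      have "K * B * s \<le> (K * B + 1) * s" using s by (simp add: algebra_simps)
      also have "\<dots> \<le> (K * B + 1) * (1 / (2 * (K * B + 1)))"
        using small[OF \<delta>(1) le(1)] pos by (intro mult_left_mono) (auto simp: s_def)
      also have "\<dots> = 1 / 2" using pos by (simp add: field_simps)
      finally show "K * B * s \<le> 1 / 2" .
    qed (fact \<open>w \<delta> \<ge> 0\<close>)
    finally have "w \<delta> \<le> 4 * K * B * a * s" by simp
    also have "\<dots> \<le> (4 * K * B * a + 1) * s" using s by (simp add: algebra_simps)
    finally show ?thesis by (simp add: w_def s_def mult.assoc)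
  qed
  moreover have "0 < 4 * K * B * a + 1"
    using K B \<open>0 \<le> a\<close> by (simp add: add_nonneg_pos)
  moreover have "0 < d0" "d0 < 1" using d by (auto simp: d0_def min_less_iff_disj)
  ultimately show ?thesis by blast
qed

end
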